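(* Let $(A,B)$ be a pair of invertible complex $3\times3$ matrices in general position. Let $(h_1,h_2,h_3)$ be a fixed ordering of the eigenvalues of $A$, let $d_1,d_2,p_\pm,q_\pm,r_\pm,t$ be the coefficients of the spectral curve of $(A,B)$, and let $(L:M:1)$ be the distinguished point of $(A,B)$. Let $d_1^*,d_2^*,p_\pm^*,q_\pm^*,r_\pm^*,t^*$ be the coefficients of the spectral curve of $(A,AB)$, and let $(L^*:M^*:1)$ be the distinguished point of $(A,AB)$ with respect to the same ordering $(h_1,h_2,h_3)$. Then the matrix $\begin{pmatrix}1&1\\0&1\end{pmatrix}\in\mathrm{GL}(2,\mathbb{Z})$, i.e. the operation $(A,B)\mapsto(A,AB)$, corresponds to the following transformation of the space of cubic curves with distinguished points: the coefficients $d_1,p_\pm$ are the same ($d_1^*=d_1$, $p_\pm^*=p_\pm$), and $$d_2^*=d_1d_2,\quad q_+^*=q_+p_+-t,\quad q_-^*=d_1\widetilde r_-,\quad r_+^*=d_1q_+,\quad r_-^*=d_1q_-,\quad t^*=p_-q_+-r_+,$$ $$L^*=-h_2h_3M,\qquad M^*=L+M(h_2+h_3),$$ where $$\begin{aligned}\widetilde r_-=-\frac1{h_1h_2h_3}\Bigl[&(h_1-h_2)(h_1-h_3)(L+Mh_2)(L+Mh_3)\\&+L\bigl(r_+-th_1+q_+(-h_2h_3+h_1h_3+h_1h_2)\bigr)\\&+M\bigl(r_+(h_2+h_3-h_1)-th_2h_3+q_+h_1h_2h_3\bigr)\\&+q_-h_1(h_2+h_3)-h_1r_-\Bigr].\e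nd{aligned}$$
   Context: Coefficients of the spectral curve. For a pair $(A,B)$ of invertible complex $3\times3$ matrices write $$\det(\lambda+\mu A+\nu B)=\lambda^3+d_1\mu^3+d_2\nu^3+p_+\lambda^2\mu+p_-\lambda\mu^2+q_+\lambda^2\nu+q_-\lambda\nu^2+r_+\mu^2\nu+r_-\mu\nu^2+t\lambda\mu\nu .$$ The spectral curve is the plane cubic $\det(\lambda+\mu A+\nu B)=0$ in $\mathbb{CP}^2$ with coordinates $(\lambda:\mu:\nu)$. Distinguished point. Let the first matrix $A$ of the pair have distinct eigenvalues, listed in a fixed order $h_1,h_2,h_3$. In a basis of eigenvectors of $A$ (in this order) we have $A=\mathrm{diag}(h_1,h_2,h_3)$, and $B$ has a matrix $U=(u_{ij})$, defined up to conjugation by a diagonal matrix. For a pair in general position $u_{12}u_{13}\neq0$. Put $$L=\frac{u_{12}h_3(u_{12}u_{23}-u_{13}u_{22})+u_{13}h_2(u_{12}u_{33}-u_{13}u_{32})}{u_{12}u_{13}(h_3-h_2)},$$ $$M=-\frac{u_{12}(u_{12}u_{23}-u_{13}u_{22})+u_{13}(u_{12}u_{33}-u_{13}u_{32})}{u_{12}u_{13}(h_3-h_2)}.$$ The distinguished point of $(A,B)$ with respect to this ordering is $(L:M:1)$; it lies on the spectral curve. It is the point with $\nu=1$ for which $\ker(\lambda+\mu A+\nu B)$ contains a nonzero vector whose first coordinate in the eigenbasis of $A$ is $0$. The group $\mathrm{GL}(2,\mathbb{Z})\cong\mathrm{Out}(F_2)$ (outer automorphisms of the free group on $c_1,c_2$)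 acts on pairs of invertible matrices modulo simultaneous conjugation by substituting $A,B$ for $c_1,c_2$ in the images of the generators; here the matrix $\begin{pmatrix}1&1\\0&1\end{pmatrix}$ is the one assigned to the class of $(c_1,c_2)\mapsto(c_1,c_1c_2)$.
   Formalization: The printed formula for r̃_- has a sign error (A=diag(1,2,3), B with rows (1,1,1),(0,1,0),(0,0,1) gives q_-^*=11, not -15); here all terms in the bracket after (h1-h2)(h1-h3)(L+Mh2)(L+Mh3) are subtracted instead of added. *)

theory Defs
  imports "HOL-Analysis.Analysis"
begin

(* Here "mat l" is the scalar matrix l, so "mat m ** A" is the scalar multiple m A. An identity
   of values at all complex (l, m, n) is the same as an identity of polynomials, hence the
   coefficients are determined by the pair. *)
definition spectral_coefficients ::
  "complex^3^3 \<Rightarrow> complex^3^3 \<Rightarrow>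
   complex \<Rightarrow> complex \<Rightarrow> complex \<Rightarrow> complex \<Rightarrow> complex \<Rightarrow> complex \<Rightarrow> complex \<Rightarrow> complex \<Rightarrow> complex \<Rightarrow> bool"
where
  "spectral_coefficients A B d1 d2 pp pm qp qm rp rm t \<longleftrightarrow>
     (\<forall>l m n :: complex.
        det (mat l + mat m ** A + mat n ** B) =
          l^3 + d1 * m^3 + d2 * n^3 + pp * l^2 * m + pm * l * m^2 + qp * l^2 * n + qm * l * n^2
          + rp * m^2 * n + rm * m * n^2 + t * l * m * n)"

definition diag_mat :: "complex^3 \<Rightarrow> complex^3^3" where
  "diag_mat h = (\<chi> i j. if i = j then h $ i else 0)"

(* The columns of P are eigenvectors of A for h$1, h$2, h$3, in this order. Since P may be
   multiplied by diagonal matrices from the right, U is not unique. *)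
definition matrix_in_eigenbasis ::
  "complex^3 \<Rightarrow> complex^3^3 \<Rightarrow> complex^3^3 \<Rightarrow> complex^3^3 \<Rightarrow> bool"
where
  "matrix_in_eigenbasis h A B U \<longleftrightarrow>
     (\<exists>P. invertible P \<and> matrix_inv P ** A ** P = diag_mat h \<and> matrix_inv P ** B ** P = U)"

(* The vanishing of an off-diagonal entry of U is not affected by conjugation by a diagonal
   matrix, so one choice of eigenbasis is enough to express the second condition. *)
definition general_position :: "complex^3 \<Rightarrow> complex^3^3 \<Rightarrow> complex^3^3 \<Rightarrow> bool" where
  "general_position h A B \<longleftrightarrow>
     h$1 \<noteq> h$2 \<and> h$1 \<noteq> h$3 \<and> h$2 \<noteq> h$3 \<and>
     (\<exists>U. matrix_in_eigenbasis h A B U \<and> U$1$2 * U$1$3 \<noteq> 0)"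

(* (L : M : 1) is the distinguished point; L and M are homogeneous of degree 0 under conjugation
   of U by diagonal matrices, so they do not depend on the eigenbasis. *)
definition distinguished_point ::
  "complex^3 \<Rightarrow> complex^3^3 \<Rightarrow> complex^3^3 \<Rightarrow> complex \<Rightarrow> complex \<Rightarrow> bool"
where
  "distinguished_point h A B L M \<longleftrightarrow>
     (\<exists>U. matrix_in_eigenbasis h A B U \<and>
        L = (U$1$2 * h$3 * (U$1$2 * U$2$3 - U$1$3 * U$2$2)
             + U$1$3 * h$2 * (U$1$2 * U$3$3 - U$1$3 * U$3$2))
            / (U$1$2 * U$1$3 * (h$3 - h$2)) \<and>
        M = - ((U$1$2 * (U$1$2 * U$2$3 - U$1$3 * U$2$2)
                + U$1$3 * (U$1$2 * U$3$3 - U$1$3 * U$3$2))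
               / (U$1$2 * U$1$3 * (h$3 - h$2))))"

definition simultaneously_conjugate ::
  "(complex^3^3) \<times> (complex^3^3) \<Rightarrow> (complex^3^3) \<times> (complex^3^3) \<Rightarrow> bool"
where
  "simultaneously_conjugate X Y \<longleftrightarrow>
     (\<exists>P. invertible P \<and> fst Y = matrix_inv P ** fst X ** P \<and> snd Y = matrix_inv P ** snd X ** P)"

(* The action of the matrix ((1, 1), (0, 1)) of GL(2,Z), that is, of the outer class of
   (c1, c2) |-> (c1, c1 c2): substitute A, B for c1, c2 in the images of the generators. *)
definition transvection :: "(complex^3^3) \<times> (complex^3^3) \<Rightarrow> (complex^3^3) \<times> (complex^3^3)" where
  "transvection X = (fst X, fst X ** snd X)"

(* The coefficient of m n^2 in det (l + m A^-1 + n B). The published formula has a plus sign in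
   place of the minus sign in front of the inner group "L * (...) + ... - h1 * rm", and is wrong:
   for A = diag (1, 2, 3) and B with rows (1, 1, 1), (0, 1, 0), (0, 0, 1) one has (L, M) = (-1, 0),
   the coefficient of l n^2 in det (l + m A + n A B) is 11, and d1 times the published expression
   is -15. The formula below gives 11. *)
definition r_minus_tilde ::
  "complex \<Rightarrow> complex \<Rightarrow> complex \<Rightarrow> complex \<Rightarrow> complex \<Rightarrow> complex \<Rightarrow> complex \<Rightarrow> complex \<Rightarrow> complex \<Rightarrow> complex \<Rightarrow> complex"
where
  "r_minus_tilde h1 h2 h3 L M qp qm rp rm t =
     - (1 / (h1 * h2 * h3)) *
       ((h1 - h2) * (h1 - h3) * (L + M * h2) * (L + M * h3)
        - (L * (rp - t * h1 + qp * (- h2 * h3 + h1 * h3 + h1 * h2))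
           + M * (rp * (h2 + h3 - h1) - t * h2 * h3 + qp * h1 * h2 * h3)
           + qm * h1 * (h2 + h3) - h1 * rm))"

end

(* In an eigenbasis of A the pair (A, B) becomes (diag h, U), and (A, A B) becomes
   (diag h, diag h U) in the same basis, so every coefficient is an explicit polynomial in h and U.
   The distinguished point is determined by
     L + M h2 + u22 = u12 u23 / u13   and   L + M h3 + u33 = u13 u32 / u12,
   whose right-hand sides do not depend on the eigenbasis. Passing from U to diag h U multiplies
   L + M h2 by h2 and L + M h3 by h3, which gives L* and M*. Multiplying the two equations gives
   (L + M h2 + u22) (L + M h3 + u33) = u23 u32; this relation supplies the coefficient of
   lambda nu^2, the only one that is not a function of the old coefficients alone. *)
theory Submission
  imports Defs
begin

lemma matrix_inv_mult_self:
  fixes P :: "'a::field^'n^'n"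
  assumes "invertible P"
  shows "P ** matrix_inv P = mat 1" and "matrix_inv P ** P = mat 1"
  using someI_ex[OF assms[unfolded invertible_def]] by (simp_all add: matrix_inv_def)

lemma matrix_inv_mult:
  fixes P Q :: "'a::field^'n^'n"
  assumes "invertible P" "invertible Q"
  shows "matrix_inv (P ** Q) = matrix_inv Q ** matrix_inv P"
proof -
  have "matrix_inv (P ** Q) = matrix_inv (P ** Q) ** (P ** (Q ** matrix_inv Q) ** matrix_inv P)"
    using assms by (simp add: matrix_inv_mult_self)
  also have "\<dots> = (matrix_inv (P ** Q) ** (P ** Q)) ** (matrix_inv Q ** matrix_inv P)"
    by (simp only: matrix_mul_assoc)
  also have "\<dots> = matrix_inv Q ** matrix_inv P"
    using assms by (simp add: invertible_mult matrix_inv_mult_self(2))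
  finally show ?thesis .
qed

lemma det_conjugate:
  fixes P X :: "'a::field^'n^'n"
  assumes "invertible P"
  shows "det (matrix_inv P ** X ** P) = det X"
proof -
  have "det (matrix_inv P) * det P = 1"
    using matrix_inv_mult_self(2)[OF assms] by (metis det_I det_mul)
  then show ?thesis
    by (simp add: det_mul mult.assoc mult.left_commute[of _ "det X"])
qed

lemma matrix_add_rdistrib:
  fixes X Y :: "'a::semiring_1^'n^'m"
  shows "(X + Y) ** Z = X ** Z + Y ** Z"
  by (simp add: matrix_matrix_mult_def vec_eq_iff distrib_right sum.distrib)

lemma mat_mult_commute:
  fixes X :: "'a::comm_semiring_1^'n^'n"
  shows "mat c ** X = X ** mat c"
  by (simp add: matrix_matrix_mult_def mat_def vec_eq_iff if_distrib if_distribR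
      sum.delta sum.delta' mult.commute cong: if_cong)

text \<open>Scalar matrices are central, so conjugating \<open>A\<close> and \<open>B\<close>
  conjugates the whole pencil and leaves its determinant unchanged. The form as an equality of
  predicates allows rewriting for all coefficients at once.\<close>

lemma spectral_coefficients_conjugate:
  assumes "invertible P"
  shows "spectral_coefficients (matrix_inv P ** A ** P) (matrix_inv P ** B ** P)
    = spectral_coefficients A B"
proof -
  have "det (mat l + mat m ** (matrix_inv P ** A ** P) + mat n ** (matrix_inv P ** B ** P))
      = det (mat l + mat m ** A + mat n ** B)" for l m n
  proof -
    have scalar: "mat c ** (matrix_inv P ** X ** P) = matrix_inv P ** (mat c ** X) ** P"
      for c and X :: "complex^3^3"
      by (metis mat_mult_commute matrix_mul_assoc)
    have "mat l = matrix_inv P ** mat l ** P"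
      by (metis assms mat_mult_commute matrix_inv_mult_self(2) matrix_mul_assoc matrix_mul_rid)
    then have "mat l + mat m ** (matrix_inv P ** A ** P) + mat n ** (matrix_inv P ** B ** P)
        = matrix_inv P ** (mat l + mat m ** A + mat n ** B) ** P"
      by (simp add: scalar matrix_add_ldistrib matrix_add_rdistrib)
    then show ?thesis
      by (simp add: det_conjugate[OF assms])
  qed
  then show ?thesis
    by (intro ext) (simp add: spectral_coefficients_def)
qed

lemma matrix_in_eigenbasis_spectral_coefficients:
  assumes "matrix_in_eigenbasis h A B U"
  shows "spectral_coefficients A B = spectral_coefficients (diag_mat h) U"
  using assms spectral_coefficients_conjugate unfolding matrix_in_eigenbasis_def by metis

text \<open>An eigenbasis \<open>P\<close> of the conjugated pair gives the eigenbasis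
  \<open>Q ** P\<close> of the original one. This carries the distinguished point of an arbitrary
  representative of the conjugacy class back to \<open>(A, A ** B)\<close>.\<close>

lemma matrix_in_eigenbasis_conjugate:
  assumes "invertible Q"
    and "matrix_in_eigenbasis h (matrix_inv Q ** A ** Q) (matrix_inv Q ** B ** Q) U"
  shows "matrix_in_eigenbasis h A B U"
proof -
  obtain P where "invertible P"
    and "matrix_inv P ** (matrix_inv Q ** A ** Q) ** P = diag_mat h"
    and "matrix_inv P ** (matrix_inv Q ** B ** Q) ** P = U"
    using assms(2) unfolding matrix_in_eigenbasis_def by blast
  then show ?thesis
    unfolding matrix_in_eigenbasis_def using assms(1)
    by (intro exI[of _ "Q ** P"]) (simp add: matrix_inv_mult invertible_mult matrix_mul_assoc)
qed

text \<open>Inserting \<open>P ** matrix_inv P\<close> between \<open>A\<close> and \<open>B\<close>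
  shows that the same \<open>P\<close> serves both pairs, which can then be compared entry by
  entry.\<close>

lemma matrix_in_eigenbasis_mult:
  assumes "matrix_in_eigenbasis h A B U"
  shows "matrix_in_eigenbasis h A (A ** B) (diag_mat h ** U)"
proof -
  obtain P where P: "invertible P" "matrix_inv P ** A ** P = diag_mat h" "matrix_inv P ** B ** P = U"
    using assms unfolding matrix_in_eigenbasis_def by blast
  have "matrix_inv P ** (A ** B) ** P
      = matrix_inv P ** A ** (P ** matrix_inv P) ** B ** P"
    by (simp add: matrix_inv_mult_self(1)[OF P(1)] matrix_mul_assoc)
  also have "\<dots> = diag_mat h ** U"
    unfolding P(2,3)[symmetric] by (simp add: matrix_mul_assoc)
  finally show ?thesis
    using P unfolding matrix_in_eigenbasis_def by blast
qed

lemma diag_mat_mult [simp]: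
  "(diag_mat h ** X) $ i $ j = h $ i * X $ i $ j"
  "(X ** diag_mat h) $ i $ j = X $ i $ j * h $ j"
  by (simp_all add: diag_mat_def matrix_matrix_mult_def if_distrib if_distribR
      sum.delta sum.delta' cong: if_cong)

text \<open>The change of basis between two ordered eigenbases commutes with
  \<open>diag_mat h\<close>. Since the eigenvalues are distinct, it is diagonal, and
  \<open>c\<close> is its diagonal.\<close>

lemma matrix_in_eigenbasis_unique:
  assumes "matrix_in_eigenbasis h A B U" and "matrix_in_eigenbasis h A B V"
    and "h$1 \<noteq> h$2" "h$1 \<noteq> h$3" "h$2 \<noteq> h$3"
  obtains c :: "complex^3" where "\<And>i. c $ i \<noteq> 0" and "\<And>i j. c $ i * V $ i $ j = U $ i $ j * c $ j"
proof -
  obtain P Q where P: "invertible P" "matrix_inv P ** A ** P = diag_mat h" "matrix_inv P ** B ** P = U"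
    and Q: "invertible Q" "matrix_inv Q ** A ** Q = diag_mat h" "matrix_inv Q ** B ** Q = V"
    using assms(1,2) unfolding matrix_in_eigenbasis_def by blast
  define C where "C = matrix_inv P ** Q"
  \<comment> \<open>Both sides equal \<open>matrix_inv P ** X ** Q\<close>.\<close>
  have inter: "(matrix_inv P ** X ** P) ** C = C ** (matrix_inv Q ** X ** Q)" for X
    unfolding C_def
    by (metis P(1) Q(1) matrix_inv_mult_self(1) matrix_mul_assoc matrix_mul_rid)
  have C: "diag_mat h ** C = C ** diag_mat h" "U ** C = C ** V"
    using inter[of A] inter[of B] P(2,3) Q(2,3) by simp_all
  have "h $ i \<noteq> h $ j" if "i \<noteq> j" for i j
    using that assms(3-5) exhaust_3[of i] exhaust_3[of j] by auto
  moreover have "h $ i * C $ i $ j = C $ i $ j * h $ j" for i j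
    using arg_cong[OF C(1), of "\<lambda>X. X $ i $ j"] by simp
  ultimately have off: "C $ i $ j = 0" if "i \<noteq> j" for i j
    using that by (metis mult.commute mult_cancel_left)
  define c where "c = (\<chi> i. C $ i $ i)"
  have C_diag: "C = diag_mat c"
    using off by (simp add: vec_eq_iff diag_mat_def c_def)
  \<comment> \<open>The second factor belongs to the inverse of \<open>C\<close>, so the product of
    the diagonal entries of \<open>C\<close> cannot vanish.\<close>
  have "det C * det (matrix_inv Q ** P) = det (mat 1 :: complex^3^3)"
    unfolding C_def det_mul[symmetric]
    by (metis P(1) Q(1) matrix_inv_mult_self matrix_mul_assoc matrix_mul_rid)
  then have "c $ 1 * c $ 2 * c $ 3 \<noteq> 0"
    unfolding C_diag det_I by (auto simp: det_3 diag_mat_def)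
  then have "c $ i \<noteq> 0" for i
    using exhaust_3[of i] by auto
  moreover have "c $ i * V $ i $ j = U $ i $ j * c $ j" for i j
    using arg_cong[OF C(2)[unfolded C_diag], of "\<lambda>X. X $ i $ j"] by simp
  ultimately show thesis
    using that by blast
qed

text \<open>With \<open>\<nu> = 1\<close>, these two equations say that the vector \<open>(0, u\<^sub>1\<^sub>3, - u\<^sub>1\<^sub>2)\<close>
  is in the kernel of \<open>L + M diag h + U\<close>.\<close>
lemma distinguished_point_kernel:
  assumes "distinguished_point h A B L M" and U: "matrix_in_eigenbasis h A B U"
    and h: "h$1 \<noteq> h$2" "h$1 \<noteq> h$3" "h$2 \<noteq> h$3"
    and nz: "U$1$2 \<noteq> 0" "U$1$3 \<noteq> 0"
  shows "(L + M * h$2 + U$2$2) * U$1$3 = U$1$2 * U$2$3"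
    and "(L + M * h$3 + U$3$3) * U$1$2 = U$1$3 * U$3$2"
proof -
  obtain V where V: "matrix_in_eigenbasis h A B V"
    and L: "L = (V$1$2 * h$3 * (V$1$2 * V$2$3 - V$1$3 * V$2$2)
             + V$1$3 * h$2 * (V$1$2 * V$3$3 - V$1$3 * V$3$2)) / (V$1$2 * V$1$3 * (h$3 - h$2))"
    and M: "M = - ((V$1$2 * (V$1$2 * V$2$3 - V$1$3 * V$2$2)
             + V$1$3 * (V$1$2 * V$3$3 - V$1$3 * V$3$2)) / (V$1$2 * V$1$3 * (h$3 - h$2)))"
    using assms(1) unfolding distinguished_point_def by blast
  \<comment> \<open>The matrix \<open>V\<close> behind \<open>L\<close> and \<open>M\<close> may
    differ from the given \<open>U\<close>, but only by a diagonal rescaling.\<close>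
  obtain c :: "complex^3" where c: "\<And>i. c $ i \<noteq> 0"
    and UV: "\<And>i j. c $ i * V $ i $ j = U $ i $ j * c $ j"
    using matrix_in_eigenbasis_unique[OF U V h] by blast
  have V_eq: "V $ i $ j = U $ i $ j * c $ j / c $ i" for i j
    using UV[of i j] c[of i] by (simp add: field_simps)
  have nzV: "V$1$2 \<noteq> 0" "V$1$3 \<noteq> 0"
    using nz c by (simp_all add: V_eq)
  have h32: "h$3 - h$2 \<noteq> 0"
    using h(3) by simp
  \<comment> \<open>The terms containing the third row of \<open>V\<close> cancel, and so does
    \<open>h$3 - h$2\<close>. In \<open>V$1$2 * V$2$3 / V$1$3\<close> the rescaling factors cancel
    too, so \<open>V\<close> may be replaced by \<open>U\<close>.\<close>
  have "L + M * h$2 = V$1$2 * V$2$3 / V$1$3 - V$2$2"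
    unfolding L M using nzV h32 by (simp add: divide_simps) algebra
  then show "(L + M * h$2 + U$2$2) * U$1$3 = U$1$2 * U$2$3"
    using nz c[of 1] c[of 2] c[of 3] by (simp add: V_eq field_simps)
  have "L + M * h$3 = V$1$3 * V$3$2 / V$1$2 - V$3$3"
    unfolding L M using nzV h32 by (simp add: divide_simps) algebra
  then show "(L + M * h$3 + U$3$3) * U$1$2 = U$1$3 * U$3$2"
    using nz c[of 1] c[of 2] c[of 3] by (simp add: V_eq field_simps)
qed

text \<open>Points with coordinates 0, 1 and -1 suffice: unit vectors give the pure cubes, points
  with one zero coordinate give the terms in two variables, and \<open>(1, 1, 1)\<close> gives the
  last term.\<close>

lemma ternary_cubic_eqD:
  fixes a1 a2 a3 a4 a5 a6 a7 a8 a9 :: complex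
  assumes "\<And>l m n. l^3 + a1 * m^3 + a2 * n^3 + a3 * l^2 * m + a4 * l * m^2 + a5 * l^2 * n
      + a6 * l * n^2 + a7 * m^2 * n + a8 * m * n^2 + a9 * l * m * n
    = l^3 + b1 * m^3 + b2 * n^3 + b3 * l^2 * m + b4 * l * m^2 + b5 * l^2 * n
      + b6 * l * n^2 + b7 * m^2 * n + b8 * m * n^2 + b9 * l * m * n"
  shows "a1 = b1 \<and> a2 = b2 \<and> a3 = b3 \<and> a4 = b4 \<and> a5 = b5 \<and> a6 = b6 \<and> a7 = b7 \<and> a8 = b8 \<and> a9 = b9"
proof -
  \<comment> \<open>Changing the sign of one variable turns the sum of two unknown coefficients into
    their difference; together these determine both, as 2 is invertible.\<close>
  have sum_diff: "x = x' \<and> y = y'" if "x + y = x' + y'" "y - x = y' - x'" for x y x' y' :: complex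
    using that by algebra
  have 1: "a1 = b1" "a2 = b2"
    using assms[of 0 1 0] assms[of 0 0 1] by simp_all
  have 2: "a3 = b3 \<and> a4 = b4" "a5 = b5 \<and> a6 = b6"
    using assms[of 1 1 0] assms[of 1 "-1" 0] assms[of 1 0 1] assms[of 1 0 "-1"]
    by (intro sum_diff; simp add: 1 add.assoc)+
  have 3: "a7 = b7 \<and> a8 = b8"
    using assms[of 0 1 1] assms[of 0 1 "-1"] 1 by (intro sum_diff) (simp_all add: add.assoc)
  show ?thesis
    using 1 2 3 assms[of 1 1 1] by simp
qed

text \<open>For a diagonal matrix \<open>D\<close>, the determinant of \<open>D + n U\<close> is a
  sum over index sets: \<open>n\<close> to the size of the set, times the principal minor of
  \<open>U\<close> on it, times the entries of \<open>D\<close> outside it. Here \<open>D\<close>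
  has the entries \<open>l + m * h$i\<close>.\<close>

lemma spectral_coefficients_diag:
  assumes "spectral_coefficients (diag_mat h) U d1 d2 pp pm qp qm rp rm t"
  shows "d1 = h$1 * h$2 * h$3 \<and> d2 = det U \<and>
    pp = h$1 + h$2 + h$3 \<and> pm = h$1 * h$2 + h$1 * h$3 + h$2 * h$3 \<and>
    qp = U$1$1 + U$2$2 + U$3$3 \<and>
    qm = (U$2$2 * U$3$3 - U$2$3 * U$3$2) + (U$1$1 * U$3$3 - U$1$3 * U$3$1)
       + (U$1$1 * U$2$2 - U$1$2 * U$2$1) \<and>
    rp = h$2 * h$3 * U$1$1 + h$1 * h$3 * U$2$2 + h$1 * h$2 * U$3$3 \<and>
    rm = h$1 * (U$2$2 * U$3$3 - U$2$3 * U$3$2) + h$2 * (U$1$1 * U$3$3 - U$1$3 * U$3$1)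
       + h$3 * (U$1$1 * U$2$2 - U$1$2 * U$2$1) \<and>
    t = (h$2 + h$3) * U$1$1 + (h$1 + h$3) * U$2$2 + (h$1 + h$2) * U$3$3"
proof (rule ternary_cubic_eqD)
  fix l m n :: complex
  have mat: "(mat x ** X) $ i $ j = x * X $ i $ j" for x and X :: "complex^3^3" and i j
    by (simp add: matrix_matrix_mult_def mat_def if_distrib if_distribR sum.delta sum.delta' cong: if_cong)
  show "l^3 + d1 * m^3 + d2 * n^3 + pp * l^2 * m + pm * l * m^2 + qp * l^2 * n + qm * l * n^2
          + rp * m^2 * n + rm * m * n^2 + t * l * m * n
    = l^3 + (h$1 * h$2 * h$3) * m^3 + det U * n^3 + (h$1 + h$2 + h$3) * l^2 * m
     + (h$1 * h$2 + h$1 * h$3 + h$2 * h$3) * l * m^2 + (U$1$1 + U$2$2 + U$3$3) * l^2 * n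
     + ((U$2$2 * U$3$3 - U$2$3 * U$3$2) + (U$1$1 * U$3$3 - U$1$3 * U$3$1)
       + (U$1$1 * U$2$2 - U$1$2 * U$2$1)) * l * n^2
     + (h$2 * h$3 * U$1$1 + h$1 * h$3 * U$2$2 + h$1 * h$2 * U$3$3) * m^2 * n
     + (h$1 * (U$2$2 * U$3$3 - U$2$3 * U$3$2) + h$2 * (U$1$1 * U$3$3 - U$1$3 * U$3$1)
       + h$3 * (U$1$1 * U$2$2 - U$1$2 * U$2$1)) * m * n^2
     + ((h$2 + h$3) * U$1$1 + (h$1 + h$3) * U$2$2 + (h$1 + h$2) * U$3$3) * l * m * n"
    unfolding assms[unfolded spectral_coefficients_def, rule_format, of l m n, symmetric]
    by (simp add: det_3 mat) (simp add: mat_def diag_mat_def, algebra)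
qed

theorem proposition3p3:
  fixes A B A' B' :: "complex^3^3" and h :: "complex^3"
    and d1 d2 pp pm qp qm rp rm t L M :: complex
    and d1' d2' pp' pm' qp' qm' rp' rm' t' L' M' :: complex
  assumes "invertible A" and "invertible B"
    and "general_position h A B"
    and "spectral_coefficients A B d1 d2 pp pm qp qm rp rm t"
    and "distinguished_point h A B L M"
    and "simultaneously_conjugate (transvection (A, B)) (A', B')"
    and "spectral_coefficients A' B' d1' d2' pp' pm' qp' qm' rp' rm' t'"
    and "distinguished_point h A' B' L' M'"
  shows "d1' = d1 \<and> pp' = pp \<and> pm' = pm \<and>
    d2' = d1 * d2 \<and>
    qp' = qp * pp - t \<and>
    qm' = d1 * r_minus_tilde (h$1) (h$2) (h$3) L M qp qm rp rm t \<and>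
    rp' = d1 * qp \<and>
    rm' = d1 * qm \<and>
    t' = pm * qp - rp \<and>
    L' = - (h$2 * h$3 * M) \<and>
    M' = L + M * (h$2 + h$3)"
proof -
  obtain U where h: "h$1 \<noteq> h$2" "h$1 \<noteq> h$3" "h$2 \<noteq> h$3"
    and U: "matrix_in_eigenbasis h A B U" and nz: "U$1$2 \<noteq> 0" "U$1$3 \<noteq> 0"
    using assms(3) unfolding general_position_def by auto
  obtain Q where Q: "invertible Q"
    and A': "A' = matrix_inv Q ** A ** Q" and B': "B' = matrix_inv Q ** (A ** B) ** Q"
    using assms(6) unfolding simultaneously_conjugate_def transvection_def by auto
  note U' = matrix_in_eigenbasis_mult[OF U]
  have sp: "spectral_coefficients (diag_mat h) U d1 d2 pp pm qp qm rp rm t"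
    using assms(4) matrix_in_eigenbasis_spectral_coefficients[OF U] by simp
  have sp': "spectral_coefficients (diag_mat h) (diag_mat h ** U) d1' d2' pp' pm' qp' qm' rp' rm' t'"
    using assms(7) matrix_in_eigenbasis_spectral_coefficients[OF U']
    by (simp add: A' B' spectral_coefficients_conjugate[OF Q])
  have dp': "distinguished_point h A (A ** B) L' M'"
    using assms(8) matrix_in_eigenbasis_conjugate[OF Q] unfolding A' B' distinguished_point_def
    by blast
  note coeffs = spectral_coefficients_diag[OF sp]
  note coeffs' = spectral_coefficients_diag[OF sp', unfolded diag_mat_mult]
  have det_h: "det (diag_mat h) = h$1 * h$2 * h$3"
    by (simp add: det_3 diag_mat_def)
  \<comment> \<open>Nonzero eigenvalues permit cancelling \<open>h$1\<close> below and clearing the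
    denominator of \<open>r_minus_tilde\<close>.\<close>
  have "det (diag_mat h) \<noteq> 0"
    using U assms(1) det_conjugate unfolding matrix_in_eigenbasis_def invertible_det_nz by metis
  then have h0: "h$1 \<noteq> 0" "h$2 \<noteq> 0" "h$3 \<noteq> 0"
    by (auto simp: det_h)
  note ker = distinguished_point_kernel[OF assms(5) U h nz]
  have nz': "(diag_mat h ** U)$1$2 \<noteq> 0" "(diag_mat h ** U)$1$3 \<noteq> 0"
    using nz h0 by simp_all
  note ker' = distinguished_point_kernel[OF dp' U' h nz', simplified]
  \<comment> \<open>Row \<open>i\<close> of \<open>diag_mat h ** U\<close> is row \<open>i\<close>
    of \<open>U\<close> times \<open>h$i\<close>. Hence \<open>ker'(1)\<close> has the factor
    \<open>h$1\<close> on both sides, and comparison with \<open>h$2\<close> times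
    \<open>ker(1)\<close> eliminates \<open>U$2$2\<close> and \<open>U$2$3\<close>.\<close>
  have "h$1 * U$1$3 * (L' + M' * h$2) = h$1 * U$1$3 * (h$2 * (L + M * h$2))"
    using ker(1) ker'(1) by algebra
  then have e2: "L' + M' * h$2 = h$2 * (L + M * h$2)"
    using h0 nz by simp
  have "h$1 * U$1$2 * (L' + M' * h$3) = h$1 * U$1$2 * (h$3 * (L + M * h$3))"
    using ker(2) ker'(2) by algebra
  then have e3: "L' + M' * h$3 = h$3 * (L + M * h$3)"
    using h0 nz by simp
  \<comment> \<open>Subtracting \<open>e3\<close> from \<open>e2\<close> eliminates
    \<open>L'\<close>; the right-hand side factors through the difference of squares.\<close>
  have "(h$2 - h$3) * M' = (h$2 - h$3) * (L + M * (h$2 + h$3))"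
    using e2 e3 by algebra
  then have M': "M' = L + M * (h$2 + h$3)"
    using h(3) by simp
  then have L': "L' = - (h$2 * h$3 * M)"
    using e2 by algebra
  have "(U$1$2 * U$1$3) * ((L + M * h$2 + U$2$2) * (L + M * h$3 + U$3$3))
      = (U$1$2 * U$1$3) * (U$2$3 * U$3$2)"
    using ker by algebra
  then have "(L + M * h$2 + U$2$2) * (L + M * h$3 + U$3$3) = U$2$3 * U$3$2"
    using nz by simp
  \<comment> \<open>With \<open>m = U$2$2 * U$3$3 - U$2$3 * U$3$2\<close>, the minors give
    \<open>qm' = h$1 * (h$2 + h$3) * qm - h$1 * rm + (h$1 - h$2) * (h$1 - h$3) * m\<close>. For
    \<open>x = L + M * h$2\<close> and \<open>y = L + M * h$3\<close>, the relation just proved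
    gives \<open>m = - (x * y + x * U$3$3 + y * U$2$2)\<close>, and \<open>qp\<close>,
    \<open>rp\<close>, \<open>t\<close> express the part linear in \<open>x\<close> and
    \<open>y\<close>.\<close>
  then have qm': "qm' = d1 * r_minus_tilde (h$1) (h$2) (h$3) L M qp qm rp rm t"
    using h0 by (simp add: r_minus_tilde_def coeffs coeffs' del: mult_minus_left) algebra
  have "d1' = d1" "pp' = pp" "pm' = pm" "d2' = d1 * d2" "qp' = qp * pp - t"
    "rp' = d1 * qp" "rm' = d1 * qm" "t' = pm * qp - rp"
    by (simp only: coeffs coeffs' det_mul det_h; algebra)+
  with qm' L' M' show ?thesis
    by blast
qed

end
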